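(* Let $(X,T)$ be a transitive dynamical system. Then $(X,T)$ is either pairwise thickly sensitive or almost pairwise syndetically equicontinuous.
   Context: A dynamical system is a pair $(X,T)$ where $X$ is a compact metric space with metric $d$ and $T\colon X\to X$ is a continuous surjection. $\mathbb{N}$ is the set of positive integers. For a point $x$, $\omega(x,T)$ denotes the set of limit points of the sequence $(T^kx)_{k\ge 1}$, i.e. of all limits of $T^{k_i}x$ with $k_i\to\infty$. A system $(X,T)$ is transitive if there is $x\in X$ with $\omega(x,T)=X$. A set $F\subset\mathbb{N}$ is thick if for every $L\in\mathbb{N}$ there is $m\in\mathbb{N}$ with $\{m,m+1,\dots,m+L\}\subset F$; it is syndetic if there is $M\in\mathbb{N}$ with $F\cap\{m,m+1,\dots,m+M\}\ne\emptyset$ for all $m\in\mathbb{N}$. $(X,T)$ is pairwise thickly sensitive if there is $\delta>0$ such that for every non-empty open $U\subset X$ there exist $x_1,x_2\in U$ such that $\{k\in\mathbb{N}: d(T^kx_1,T^kx_2)>\delta\}$ is thick. A point $x\in X$ is pairwise syndetically equicontinuous if for every $\varepsilon>0$ there is a neighbourhood $U$ of $x$ such that for all $y,z\in U$, $\{k\in\mathbb{N}:d(T^ky,T^kz)<\varepsilon\}$ is syndetic. $(X,T)$ is almost pairwise syndetically equicontinuous if the set of pairwise syndetically equicontinuous points is residual in $X$ (contains a dense $G_\delta$ set). *)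

theory Defs
  imports "HOL-Analysis.Analysis"
begin

text \<open>A system lives on a compact subset \<open>X\<close> of an arbitrary metric space, with the restricted
  metric; \<open>T\<close> is only constrained on \<open>X\<close>, and all topological notions are relative to \<open>X\<close>.\<close>

definition dynamical_system :: "'a::metric_space set \<Rightarrow> ('a \<Rightarrow> 'a) \<Rightarrow> bool" where
  "dynamical_system X T \<longleftrightarrow> compact X \<and> continuous_on X T \<and> T ` X = X"

definition omega_limit :: "('a::metric_space \<Rightarrow> 'a) \<Rightarrow> 'a \<Rightarrow> 'a set" where
  "omega_limit T x =
     {y. \<exists>k :: nat \<Rightarrow> nat. filterlim k at_top sequentially \<and> (\<lambda>i. (T ^^ k i) x) \<longlonglongrightarrow> y}"

definition transitive_system :: "'a::metric_space set \<Rightarrow> ('a \<Rightarrow> 'a) \<Rightarrow> bool" where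
  "transitive_system X T \<longleftrightarrow> dynamical_system X T \<and> (\<exists>x\<in>X. omega_limit T x = X)"

text \<open>Thickness and syndeticity are for sets of positive integers, so every index below is
  explicitly required to be positive.\<close>

definition thick :: "nat set \<Rightarrow> bool" where
  "thick F \<longleftrightarrow> (\<forall>L>0. \<exists>m>0. {m..m + L} \<subseteq> F)"

definition syndetic :: "nat set \<Rightarrow> bool" where
  "syndetic F \<longleftrightarrow> (\<exists>M>0. \<forall>m>0. F \<inter> {m..m + M} \<noteq> {})"

definition pairwise_thickly_sensitive :: "'a::metric_space set \<Rightarrow> ('a \<Rightarrow> 'a) \<Rightarrow> bool" where
  "pairwise_thickly_sensitive X T \<longleftrightarrow>
     (\<exists>\<delta>>0. \<forall>U. openin (top_of_set X) U \<and> U \<noteq> {} \<longrightarrow>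
        (\<exists>x1\<in>U. \<exists>x2\<in>U. thick {k. k > 0 \<and> dist ((T ^^ k) x1) ((T ^^ k) x2) > \<delta>}))"

definition pairwise_syndetically_equicontinuous_point ::
    "'a::metric_space set \<Rightarrow> ('a \<Rightarrow> 'a) \<Rightarrow> 'a \<Rightarrow> bool" where
  "pairwise_syndetically_equicontinuous_point X T x \<longleftrightarrow>
     x \<in> X \<and>
     (\<forall>\<epsilon>>0. \<exists>U. openin (top_of_set X) U \<and> x \<in> U \<and>
        (\<forall>y\<in>U. \<forall>z\<in>U. syndetic {k. k > 0 \<and> dist ((T ^^ k) y) ((T ^^ k) z) < \<epsilon>}))"

definition residual_in :: "'a topology \<Rightarrow> 'a set \<Rightarrow> bool" where
  "residual_in Y A \<longleftrightarrow> (\<exists>G. gdelta_in Y G \<and> Y closure_of G = topspace Y \<and> G \<subseteq> A)"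

definition almost_pairwise_syndetically_equicontinuous ::
    "'a::metric_space set \<Rightarrow> ('a \<Rightarrow> 'a) \<Rightarrow> bool" where
  "almost_pairwise_syndetically_equicontinuous X T \<longleftrightarrow>
     residual_in (top_of_set X) {x. pairwise_syndetically_equicontinuous_point X T x}"

end

theory Submission
  imports Defs
begin

text \<open>A set of times is thick unless its complement is syndetic. If the system is not pairwise
  thickly sensitive, then for each \<open>\<epsilon>\<close> some non-empty open set \<open>U\<close> has the property that the orbits
  of any two of its points are \<open>\<epsilon>\<close>-close syndetically often. Since syndeticity survives shifts, this
  property passes to \<open>T\<^sup>-\<^sup>s U\<close>, and by transitivity these preimages meet every open set. So the points
  having such a neighbourhood form a dense open set, and Baire's theorem gives the residual set as
  \<open>\<epsilon>\<close> runs through \<open>1/(n+1)\<close>. The two properties exclude each other because a thick set meets every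
  syndetic set.\<close>

text \<open>A block of \<open>A\<close> as long as the gap bound of \<open>B\<close> cannot avoid
  \<open>B\<close>.\<close>

lemma thick_Int_syndetic:
  assumes "thick A" "syndetic B"
  shows "A \<inter> B \<noteq> {}"
proof -
  obtain M where M: "M > 0" "\<And>m. m > 0 \<Longrightarrow> B \<inter> {m..m + M} \<noteq> {}"
    using assms(2) unfolding syndetic_def by blast
  obtain m where "m > 0" "{m..m + M} \<subseteq> A"
    using assms(1) M(1) unfolding thick_def by blast
  then show ?thesis
    using M(2) by blast
qed

text \<open>A length \<open>L\<close> at which thickness fails is a gap bound for the complement.
  Taking any \<open>B\<close> that contains the positive times outside \<open>A\<close>, not just
  the complement itself, leaves room to pass from \<open>> \<epsilon> / 2\<close> to
  \<open>< \<epsilon>\<close>.\<close>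

lemma syndetic_if_not_thick:
  assumes "\<not> thick A" "\<And>k. k > 0 \<Longrightarrow> k \<notin> A \<Longrightarrow> k \<in> B"
  shows "syndetic B"
proof -
  obtain L where L: "L > 0" "\<And>m. m > 0 \<Longrightarrow> \<not> {m..m + L} \<subseteq> A"
    using assms(1) unfolding thick_def by blast
  have "B \<inter> {m..m + L} \<noteq> {}" if m: "m > 0" for m
  proof -
    obtain k where "k \<in> {m..m + L}" "k \<notin> A"
      using L(2) [OF m] by blast
    then show ?thesis
      using assms(2) [of k] m by auto
  qed
  with L(1) show ?thesis
    unfolding syndetic_def by blast
qed

lemma syndetic_mono:
  assumes "syndetic A" "A \<subseteq> B"
  shows "syndetic B"
proof -
  obtain M where M: "M > 0" "\<And>m. m > 0 \<Longrightarrow> A \<inter> {m..m + M} \<noteq> {}"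
    using assms(1) unfolding syndetic_def by blast
  have "B \<inter> {m..m + M} \<noteq> {}" if "m > 0" for m
    using M(2) [OF that] assms(2) by blast
  with M(1) show ?thesis
    unfolding syndetic_def by blast
qed

lemma syndetic_shift:
  assumes "syndetic A"
  shows "syndetic ((\<lambda>k. k + s) ` A)"
proof -
  obtain M where M: "M > 0" "\<And>m. m > 0 \<Longrightarrow> A \<inter> {m..m + M} \<noteq> {}"
    using assms unfolding syndetic_def by blast
  \<comment> \<open>Lengthening the window by \<open>s\<close> avoids looking for a time of
    \<open>A\<close> from \<open>m - s\<close> on, which might not be positive.\<close>
  have "(\<lambda>k. k + s) ` A \<inter> {m..m + (M + s)} \<noteq> {}" if m: "m > 0" for m
  proof -
    obtain k where "k \<in> A" "k \<in> {m..m + M}"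
      using M(2) [OF m] by blast
    then have "k + s \<in> (\<lambda>k. k + s) ` A \<inter> {m..m + (M + s)}"
      by auto
    then show ?thesis
      by blast
  qed
  moreover have "M + s > 0"
    using M(1) by simp
  ultimately show ?thesis
    unfolding syndetic_def by blast
qed

lemma funpow_in:
  assumes "T ` X \<subseteq> X" "x \<in> X"
  shows "(T ^^ n) x \<in> X"
  using assms by (induction n) auto

lemma continuous_on_funpow:
  assumes "continuous_on X T" "T ` X \<subseteq> X"
  shows "continuous_on X (T ^^ n)"
proof (induction n)
  case (Suc n)
  have "(T ^^ n) ` X \<subseteq> X"
    using funpow_in [OF assms(2)] by auto
  then show ?case
    using continuous_on_compose [OF Suc continuous_on_subset [OF assms(1)]] by simp
qed (simp add: id_def)

lemma openin_funpow_vimage: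
  assumes "continuous_on X T" "T ` X \<subseteq> X" "openin (top_of_set X) U"
  shows "openin (top_of_set X) {x \<in> X. (T ^^ n) x \<in> U}"
proof -
  have "(T ^^ n) \<in> X \<rightarrow> X"
    using funpow_in [OF assms(2)] by auto
  then have "openin (top_of_set X) (X \<inter> (T ^^ n) -` U)"
    using continuous_openin_preimage [OF continuous_on_funpow [OF assms(1,2)] _ assms(3)] by simp
  then show ?thesis
    by (simp add: vimage_def Int_def)
qed

text \<open>Any point of \<open>V\<close> is a limit along times tending to infinity, so visits to
  \<open>V\<close> occur arbitrarily late. The bound \<open>N\<close> serves to order visits to two
  different sets.\<close>

lemma omega_limit_visits:
  assumes "omega_limit T x = X" "T ` X \<subseteq> X" "x \<in> X" "openin (top_of_set X) V" "V \<noteq> {}"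
  obtains n where "n \<ge> N" "(T ^^ n) x \<in> V"
proof -
  obtain W where W: "open W" "V = X \<inter> W"
    using assms(4) openin_open by blast
  obtain y where y: "y \<in> X" "y \<in> W"
    using assms(5) W by blast
  then obtain k where k: "filterlim k at_top sequentially" "(\<lambda>i. (T ^^ k i) x) \<longlonglongrightarrow> y"
    using assms(1) unfolding omega_limit_def by blast
  have "\<forall>\<^sub>F i in sequentially. (T ^^ k i) x \<in> W"
    using topological_tendstoD [OF k(2) W(1) y(2)] .
  moreover have "\<forall>\<^sub>F i in sequentially. k i \<ge> N"
    using k(1) by (simp add: filterlim_at_top)
  ultimately have "\<forall>\<^sub>F i in sequentially. (T ^^ k i) x \<in> W \<and> k i \<ge> N"
    by (rule eventually_conj)
  then obtain i where "(T ^^ k i) x \<in> W" "k i \<ge> N"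
    using eventually_happens' [OF sequentially_bot] by blast
  then show thesis
    using that [of "k i"] W(2) funpow_in [OF assms(2,3)] by simp
qed

text \<open>This is the condition on the neighbourhood in
  \<open>pairwise_syndetically_equicontinuous_point\<close>, isolated so that it can be moved
  between open sets.\<close>

definition syndetically_close :: "('a::metric_space \<Rightarrow> 'a) \<Rightarrow> real \<Rightarrow> 'a set \<Rightarrow> bool" where
  "syndetically_close T \<epsilon> U \<longleftrightarrow>
     (\<forall>y\<in>U. \<forall>z\<in>U. syndetic {k. k > 0 \<and> dist ((T ^^ k) y) ((T ^^ k) z) < \<epsilon>})"

text \<open>Closeness of \<open>(T ^^ s) y\<close> and \<open>(T ^^ s) z\<close> at time
  \<open>k\<close> is closeness of \<open>y\<close> and \<open>z\<close> at time
  \<open>k + s\<close>.\<close>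

lemma syndetically_close_vimage:
  assumes "syndetically_close T \<epsilon> U" "\<And>y. y \<in> W \<Longrightarrow> (T ^^ s) y \<in> U"
  shows "syndetically_close T \<epsilon> W"
  unfolding syndetically_close_def
proof (intro ballI)
  fix y z assume "y \<in> W" "z \<in> W"
  let ?A = "{k. k > 0 \<and> dist ((T ^^ k) ((T ^^ s) y)) ((T ^^ k) ((T ^^ s) z)) < \<epsilon>}"
  have "syndetic ?A"
    using assms \<open>y \<in> W\<close> \<open>z \<in> W\<close> unfolding syndetically_close_def by blast
  then have "syndetic ((\<lambda>k. k + s) ` ?A)"
    by (rule syndetic_shift)
  moreover have "(\<lambda>k. k + s) ` ?A \<subseteq> {k. k > 0 \<and> dist ((T ^^ k) y) ((T ^^ k) z) < \<epsilon>}"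
    by (auto simp: funpow_add)
  ultimately show "syndetic {k. k > 0 \<and> dist ((T ^^ k) y) ((T ^^ k) z) < \<epsilon>}"
    by (rule syndetic_mono)
qed

lemma syndetically_close_if_not_sensitive:
  assumes "\<not> pairwise_thickly_sensitive X T" "\<epsilon> > 0"
  obtains U where "openin (top_of_set X) U" "U \<noteq> {}" "syndetically_close T \<epsilon> U"
proof -
  \<comment> \<open>Sensitivity is refuted at \<open>\<epsilon> / 2\<close>: a distance that is not
    above it is strictly below \<open>\<epsilon>\<close>.\<close>
  have "\<not> (\<forall>U. openin (top_of_set X) U \<and> U \<noteq> {} \<longrightarrow>
      (\<exists>y\<in>U. \<exists>z\<in>U. thick {k. k > 0 \<and> dist ((T ^^ k) y) ((T ^^ k) z) > \<epsilon> / 2}))"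
    using assms unfolding pairwise_thickly_sensitive_def by (meson half_gt_zero)
  then obtain U where U: "openin (top_of_set X) U" "U \<noteq> {}"
    and nt: "\<And>y z. y \<in> U \<Longrightarrow> z \<in> U \<Longrightarrow>
      \<not> thick {k. k > 0 \<and> dist ((T ^^ k) y) ((T ^^ k) z) > \<epsilon> / 2}"
    by blast
  have "syndetically_close T \<epsilon> U"
    unfolding syndetically_close_def
  proof (intro ballI)
    fix y z assume "y \<in> U" "z \<in> U"
    show "syndetic {k. k > 0 \<and> dist ((T ^^ k) y) ((T ^^ k) z) < \<epsilon>}"
      using assms(2) by (intro syndetic_if_not_thick [OF nt [OF \<open>y \<in> U\<close> \<open>z \<in> U\<close>]]) auto
  qed
  with U show thesis
    by (rule that)
qed

lemma dense_syndetically_close: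
  assumes "transitive_system X T" "\<not> pairwise_thickly_sensitive X T" "\<epsilon> > 0"
  shows "top_of_set X closure_of \<Union>{U. openin (top_of_set X) U \<and> syndetically_close T \<epsilon> U} = X"
proof -
  from assms(1) obtain x where T: "continuous_on X T" "T ` X \<subseteq> X"
    and x: "x \<in> X" "omega_limit T x = X"
    unfolding transitive_system_def dynamical_system_def by auto
  obtain U where U: "openin (top_of_set X) U" "U \<noteq> {}" "syndetically_close T \<epsilon> U"
    using syndetically_close_if_not_sensitive [OF assms(2,3)] .
  have "\<Union>{U. openin (top_of_set X) U \<and> syndetically_close T \<epsilon> U} \<inter> V \<noteq> {}"
    if V: "openin (top_of_set X) V" "V \<noteq> {}" for V
  proof -
    obtain i where i: "(T ^^ i) x \<in> V"
      using omega_limit_visits [OF x(2) T(2) x(1) V] by blast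
    \<comment> \<open>Since the orbit of \<open>x\<close> reaches \<open>U\<close> no earlier than
      its visit to \<open>V\<close> at time \<open>i\<close>, the point \<open>(T ^^ i) x\<close>
      lies both in \<open>V\<close> and in the preimage of \<open>U\<close> under
      \<open>T ^^ (j - i)\<close>.\<close>
    obtain j where j: "j \<ge> i" "(T ^^ j) x \<in> U"
      using omega_limit_visits [OF x(2) T(2) x(1) U(1,2)] by blast
    define W where "W = {y \<in> X. (T ^^ (j - i)) y \<in> U}"
    have "openin (top_of_set X) W"
      unfolding W_def by (rule openin_funpow_vimage [OF T U(1)])
    moreover have "syndetically_close T \<epsilon> W"
      by (rule syndetically_close_vimage [OF U(3), of _ "j - i"]) (simp add: W_def)
    moreover have "(T ^^ (j - i)) ((T ^^ i) x) = (T ^^ j) x"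
      using j(1) by (simp flip: funpow_add [THEN fun_cong, unfolded comp_apply])
    then have "(T ^^ i) x \<in> W"
      using j(2) funpow_in [OF T(2) x(1)] by (simp add: W_def)
    ultimately have "(T ^^ i) x \<in> \<Union>{U. openin (top_of_set X) U \<and> syndetically_close T \<epsilon> U}"
      by blast
    from IntI [OF this i] show ?thesis
      by (metis empty_iff)
  qed
  then show ?thesis
    using dense_intersects_open [of "top_of_set X"] by simp
qed

lemma almost_equicontinuous_if_not_sensitive:
  assumes "transitive_system X T" "\<not> pairwise_thickly_sensitive X T"
  shows "almost_pairwise_syndetically_equicontinuous X T"
proof -
  define G where "G n = \<Union>{U. openin (top_of_set X) U \<and> syndetically_close T (1 / real (Suc n)) U}"
    for n
  have op: "openin (top_of_set X) (G n)" for n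
    unfolding G_def by blast
  have dense: "top_of_set X closure_of G n = X" for n
    unfolding G_def by (rule dense_syndetically_close [OF assms]) simp
  have "compact X"
    using assms(1) by (simp add: transitive_system_def dynamical_system_def)
  \<comment> \<open>Baire's theorem is applied in its version for locally compact regular
    spaces.\<close>
  then have "locally_compact_space (top_of_set X)"
    by (simp add: compact_imp_locally_compact_space compact_space_subtopology)
  moreover have "regular_space (top_of_set X)"
    by (simp add: regular_space_subtopology regular_space_euclidean)
  ultimately have "top_of_set X closure_of \<Inter>(range G) = topspace (top_of_set X)"
    by (intro Baire_category) (auto simp: op dense)
  moreover have "gdelta_in (top_of_set X) (\<Inter>(range G))"
    by (rule gdelta_in_Inter) (auto intro: open_imp_gdelta_in op)
  moreover have "\<Inter>(range G) \<subseteq> {x. pairwise_syndetically_equicontinuous_point X T x}"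
  proof
    fix x assume x: "x \<in> \<Inter>(range G)"
    then have "x \<in> X"
      using openin_subset [OF op] by fastforce
    moreover have "\<exists>U. openin (top_of_set X) U \<and> x \<in> U \<and> syndetically_close T \<epsilon> U"
      if "\<epsilon> > 0" for \<epsilon>
    proof -
      obtain n where n: "1 / real (Suc n) < \<epsilon>"
        using \<open>\<epsilon> > 0\<close> nat_approx_posE by blast
      obtain U where U: "openin (top_of_set X) U" "x \<in> U" "syndetically_close T (1 / real (Suc n)) U"
        using x unfolding G_def by blast
      have "syndetically_close T \<epsilon> U"
        unfolding syndetically_close_def
      proof (intro ballI)
        fix y z assume "y \<in> U" "z \<in> U"
        then have "syndetic {k. k > 0 \<and> dist ((T ^^ k) y) ((T ^^ k) z) < 1 / real (Suc n)}"
          using U(3) unfolding syndetically_close_def by blast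
        then show "syndetic {k. k > 0 \<and> dist ((T ^^ k) y) ((T ^^ k) z) < \<epsilon>}"
          by (rule syndetic_mono) (use n in auto)
      qed
      with U show ?thesis
        by blast
    qed
    ultimately show "x \<in> {x. pairwise_syndetically_equicontinuous_point X T x}"
      unfolding pairwise_syndetically_equicontinuous_point_def syndetically_close_def by blast
  qed
  ultimately show ?thesis
    unfolding almost_pairwise_syndetically_equicontinuous_def residual_in_def by blast
qed

text \<open>With the sensitivity constant \<open>\<delta>\<close> as the \<open>\<epsilon>\<close>
  of equicontinuity, some pair in the neighbourhood would be more than \<open>\<delta>\<close> apart
  on a thick set and less than \<open>\<delta>\<close> apart on a syndetic one. These sets are
  disjoint, yet they would have to meet.\<close>

lemma no_equicontinuous_point_if_sensitive:
  assumes "pairwise_thickly_sensitive X T"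
  shows "\<not> pairwise_syndetically_equicontinuous_point X T x"
proof
  assume x: "pairwise_syndetically_equicontinuous_point X T x"
  obtain \<delta> where "\<delta> > 0" and \<delta>: "\<And>U. openin (top_of_set X) U \<Longrightarrow> U \<noteq> {} \<Longrightarrow>
      \<exists>y\<in>U. \<exists>z\<in>U. thick {k. k > 0 \<and> dist ((T ^^ k) y) ((T ^^ k) z) > \<delta>}"
    using assms unfolding pairwise_thickly_sensitive_def by blast
  obtain U where "openin (top_of_set X) U" "x \<in> U"
    and U: "\<And>y z. y \<in> U \<Longrightarrow> z \<in> U \<Longrightarrow>
      syndetic {k. k > 0 \<and> dist ((T ^^ k) y) ((T ^^ k) z) < \<delta>}"
    using x \<open>\<delta> > 0\<close> unfolding pairwise_syndetically_equicontinuous_point_def by meson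
  then obtain y z where "y \<in> U" "z \<in> U"
    "thick {k. k > 0 \<and> dist ((T ^^ k) y) ((T ^^ k) z) > \<delta>}"
    using \<delta> [of U] by blast
  from thick_Int_syndetic [OF this(3) U [OF this(1,2)]] show False
    by auto
qed

text \<open>The words "either ... or" are read as exclusive, so the second conjunct is proved as
  well.\<close>

theorem theorem4p13:
  fixes X :: "'a::metric_space set" and T :: "'a \<Rightarrow> 'a"
  assumes "transitive_system X T"
  shows "(pairwise_thickly_sensitive X T \<or> almost_pairwise_syndetically_equicontinuous X T) \<and>
    \<not> (pairwise_thickly_sensitive X T \<and> almost_pairwise_syndetically_equicontinuous X T)"
proof -
  \<comment> \<open>In a non-empty space a dense set has a point, so a residual set of
    equicontinuity points yields at least one, and a single one already rules out
    sensitivity.\<close>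
  have "X \<noteq> {}"
    using assms unfolding transitive_system_def by blast
  have "\<exists>x. pairwise_syndetically_equicontinuous_point X T x"
    if ae: "almost_pairwise_syndetically_equicontinuous X T"
  proof -
    obtain G where G: "top_of_set X closure_of G = topspace (top_of_set X)"
      "G \<subseteq> {x. pairwise_syndetically_equicontinuous_point X T x}"
      using ae unfolding almost_pairwise_syndetically_equicontinuous_def residual_in_def by blast
    have "G \<noteq> {}"
      using G(1) \<open>X \<noteq> {}\<close> by auto
    with G(2) show ?thesis
      by blast
  qed
  then show ?thesis
    using almost_equicontinuous_if_not_sensitive [OF assms] no_equicontinuous_point_if_sensitive
    by blast
qed

end
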